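(* Whenever all the series concerned are either convergent or terminating, $$\sum_{m,n=0}^\infty\frac{(3/2,m+n)(-1)^m x^{m+n+1}2^{-1-2m-2n}}{(3/2,m)(3/2,n)\,m!\,n!}H_{2m+1}(y^{1/2})\,H_{2n+1}(y^{1/2})=\sin(2xy).$$
   Context: Here $x,y$ are complex variables. $(\alpha,n)=\alpha(\alpha+1)\cdots(\alpha+n-1)$ for $n\ge1$ and $(\alpha,0)=1$ (Pochhammer symbol). $H_n$ is the Hermite polynomial in the standard normalization $\sum_{n\ge0}H_n(z)t^n/n!=e^{2zt-t^2}$. *)

theory Defs
  imports "HOL-Complex_Analysis.Complex_Analysis"
begin

text \<open>
  Hermite polynomials in the normalization given by the generating function
  exp(2 z t - t^2) = (SUM n. H_n(z) t^n / n!): the value at \<open>z\<close> is the \<open>n\<close>-th Taylor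
  coefficient, times \<open>n!\<close>, of the generating function in the variable \<open>t\<close> at \<open>0\<close>.
\<close>

definition hermite :: "nat \<Rightarrow> complex \<Rightarrow> complex" where
  "hermite n z = (deriv ^^ n) (\<lambda>t. exp (2 * z * t - t ^ 2)) 0"

lemma hermite_generating_function:
  "(\<lambda>n. hermite n z * t ^ n / fact n) sums exp (2 * z * t - t ^ 2)"
proof -
  have "(\<lambda>t. exp (2 * z * t - t ^ 2)) holomorphic_on ball 0 (norm t + 1)"
    by (intro holomorphic_intros)
  from holomorphic_power_series[OF this, of t]
  show ?thesis by (simp add: hermite_def field_simps)
qed

text \<open>
  The branch of the square root is immaterial: \<open>H\<^sub>2\<^sub>m\<^sub>+\<^sub>1\<close> and \<open>H\<^sub>2\<^sub>n\<^sub>+\<^sub>1\<close> are odd, so their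
  product at \<open>csqrt y\<close> equals that at \<open>- csqrt y\<close>.
\<close>

definition hermite_double_term :: "complex \<Rightarrow> complex \<Rightarrow> nat \<Rightarrow> nat \<Rightarrow> complex" where
  "hermite_double_term x y m n =
     pochhammer (3/2) (m + n) * (-1) ^ m * x ^ (m + n + 1) * 2 powi (- 1 - 2 * int m - 2 * int n)
       / (pochhammer (3/2) m * pochhammer (3/2) n * fact m * fact n)
       * hermite (2 * m + 1) (csqrt y) * hermite (2 * n + 1) (csqrt y)"

end

theory Submission
  imports Defs
begin

text \<open>
  Since \<open>(2m + 1)! = 4\<^sup>m (3/2, m) m!\<close>, the \<open>m\<close>-dependent factor of the summand is
  \<open>a\<^sub>m = H\<^sub>2\<^sub>m\<^sub>+\<^sub>1(z) / (2m + 1)!\<close> with \<open>z = csqrt y\<close>, and the odd part of the Hermite generating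
  function gives \<open>\<Sum> a\<^sub>m s\<^sup>m = e\<^sup>-\<^sup>s S(s)\<close> with \<open>S(s) = \<Sum> (2z)\<^sup>2\<^sup>j\<^sup>+\<^sup>1 s\<^sup>j / (2j + 1)!\<close>.
  On the diagonals \<open>m + n = k\<close> the sign \<open>(-1)\<^sup>m\<close> produces the coefficients of
  \<open>e\<^sup>s S(-s) e\<^sup>-\<^sup>s S(s) = S(-s) S(s)\<close>; these are the imaginary parts of \<open>(1 + \<i>)\<^sup>2\<^sup>k\<^sup>+\<^sup>2\<close> up to
  elementary factors, and the \<open>k\<close>-th diagonal is the term of degree \<open>k + 1\<close> of the sine series.
\<close>

lemma pochhammer_three_halves:
  "(4::complex) ^ m * pochhammer (3/2) m * fact m = fact (2 * m + 1)"
proof (induction m)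
  case (Suc m)
  have "(4::complex) ^ Suc m * pochhammer (3/2) (Suc m) * fact (Suc m) =
          (4 ^ m * pochhammer (3/2) m * fact m) * (4 * (3/2 + of_nat m) * (1 + of_nat m))"
    by (simp add: pochhammer_Suc algebra_simps)
  also have "\<dots> = fact (2 * m + 1) * (4 * (3/2 + of_nat m) * (1 + of_nat m))"
    by (simp only: Suc.IH)
  also have "\<dots> = fact (2 * Suc m + 1)"
    by (simp add: field_simps)
  finally show ?case .
qed simp

lemma sum_even_plus_odd:
  fixes f :: "nat \<Rightarrow> 'a :: comm_monoid_add"
  shows "(\<Sum>i<2 * n. f i) = (\<Sum>i<n. f (2 * i)) + (\<Sum>i<n. f (2 * i + 1))"
  by (induction n) (simp_all add: ac_simps)

text \<open>The generating function factors as exp (- t^2) * exp (2 z t), so this is a Cauchy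
  product of two exponential series; substituting \<open>fps_X ^ 2\<close> into the first leaves
  only even indices.\<close>

lemma hermite_over_fact:
  "hermite n z / fact n =
     (\<Sum>i\<le>n. (if even i then (-1) ^ (i div 2) / fact (i div 2) else 0)
        * ((2 * z) ^ (n - i) / fact (n - i)))"
proof -
  let ?Q = "fps_exp (-1::complex) oo fps_X ^ 2"
  have "(\<lambda>t. exp (- 1 * t ^ 2) * exp (2 * z * t)) has_fps_expansion ?Q * fps_exp (2 * z)"
    by (intro fps_expansion_intros has_fps_expansion_compose[of "\<lambda>t. exp (- 1 * t)" _ "\<lambda>t. t ^ 2", unfolded o_def])
       auto
  moreover have "(\<lambda>t. exp (- 1 * t ^ 2) * exp (2 * z * t)) = (\<lambda>t. exp (2 * z * t - t ^ 2))"
    by (simp add: mult_exp_exp)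
  ultimately have "(\<lambda>t. exp (2 * z * t - t ^ 2)) has_fps_expansion ?Q * fps_exp (2 * z)"
    by metis
  then have "hermite n z / fact n = (?Q * fps_exp (2 * z)) $ n"
    by (simp add: hermite_def fps_nth_fps_expansion)
  moreover have "?Q $ i = (if even i then (-1) ^ (i div 2) / fact (i div 2) else 0)" for i
    by (simp add: fps_nth_compose_X_power)
  ultimately show ?thesis
    by (simp add: fps_mult_nth atLeast0AtMost)
qed

text \<open>The expansion in s of sinh (w * sqrt s) / sqrt s. With s = t^2 this is sinh (w t) / t,
  so odd functions of t become power series in s.\<close>

definition sinh_fps :: "complex \<Rightarrow> complex fps" where
  "sinh_fps w = Abs_fps (\<lambda>j. w ^ (2 * j + 1) / fact (2 * j + 1))"

lemma hermite_odd_over_fact: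
  "hermite (2 * m + 1) z / fact (2 * m + 1) = (fps_exp (-1) * sinh_fps (2 * z)) $ m"
proof -
  let ?f = "\<lambda>i. (-1) ^ (i div 2) / fact (i div 2)
                * ((2 * z) ^ (2 * m + 1 - i) / fact (2 * m + 1 - i))"
  \<comment> \<open>The strict even bound lets the range split into equally many even and odd
    indices.\<close>
  have "hermite (2 * m + 1) z / fact (2 * m + 1) =
          (\<Sum>i<2 * Suc m. if even i then ?f i else 0)"
    unfolding hermite_over_fact by (intro sum.cong) auto
  also have "\<dots> = (\<Sum>i<Suc m. ?f (2 * i))"
    by (subst sum_even_plus_odd) simp
  also have "\<dots> = (\<Sum>i\<le>m. (-1) ^ i / fact i
                      * ((2 * z) ^ (2 * (m - i) + 1) / fact (2 * (m - i) + 1)))"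
  proof (rule sum.cong)
    fix i assume "i \<in> {..m}"
    then have "2 * m + 1 - 2 * i = 2 * (m - i) + 1" by auto
    then show "?f (2 * i) = (-1) ^ i / fact i
                 * ((2 * z) ^ (2 * (m - i) + 1) / fact (2 * (m - i) + 1))"
      by (simp only: nonzero_mult_div_cancel_left[of 2] zero_neq_numeral not_False_eq_True)
  qed auto
  finally show ?thesis
    by (simp add: fps_mult_nth sinh_fps_def atLeast0AtMost)
qed

text \<open>Both sides are the imaginary part of (1 + i)^(2k + 2): the binomial theorem keeps the
  odd powers of i, while (1 + i)^2 = 2i gives (2i)^(k + 1). The factor
  \<open>fact (k + 1) * sin_coeff (k + 1)\<close> is Im (i^(k + 1)).\<close>

lemma alternating_sum_odd_binomials:
  "(\<Sum>i\<le>k. (-1) ^ i * real (2 * k + 2 choose (2 * i + 1))) =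
     2 ^ (k + 1) * fact (k + 1) * sin_coeff (k + 1)"
proof -
  have Im_power: "Im (\<i> ^ l) = (if even l then 0 else (-1) ^ (l div 2))" for l
    by (auto elim!: evenE oddE simp: power_mult minus_one_power_iff)
  have "Im ((1 + \<i>) ^ (2 * k + 2)) = (\<Sum>l\<le>2 * k + 2. real (2 * k + 2 choose l) * Im (\<i> ^ l))"
    unfolding add.commute[of 1 \<i>] binomial_ring by (simp del: sum.atMost_Suc binomial_Suc_Suc power_Suc)
  \<comment> \<open>The top index 2k + 2 is even, so its term is real and drops out.\<close>
  also have "\<dots> = (\<Sum>l<2 * Suc k. real (2 * k + 2 choose l) * Im (\<i> ^ l))"
    by (subst lessThan_Suc_atMost[symmetric], subst sum.lessThan_Suc)
       (simp add: Im_power del: sum.lessThan_Suc)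
  also have "\<dots> = (\<Sum>i\<le>k. (-1) ^ i * real (2 * k + 2 choose (2 * i + 1)))"
    by (subst sum_even_plus_odd)
       (simp add: Im_power lessThan_Suc_atMost mult.commute del: sum.lessThan_Suc binomial_Suc_Suc)
  finally have *: "(\<Sum>i\<le>k. (-1) ^ i * real (2 * k + 2 choose (2 * i + 1))) =
                     Im ((1 + \<i>) ^ (2 * k + 2))" ..
  have "(1 + \<i>) ^ (2 * k + 2) = ((1 + \<i>) ^ 2) ^ (k + 1)"
    unfolding power_mult[symmetric] by simp
  also have "(1 + \<i>) ^ 2 = 2 * \<i>"
    by (simp add: power2_eq_square algebra_simps)
  also have "(2 * \<i>) ^ (k + 1) = of_real (2 ^ (k + 1)) * \<i> ^ (k + 1)"
    by (simp only: power_mult_distrib of_real_power of_real_numeral)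
  also have "Im \<dots> = 2 ^ (k + 1) * Im (\<i> ^ (k + 1))"
    by (simp only: times_complex.sel Re_complex_of_real Im_complex_of_real mult_zero_left add_0_right)
  finally show ?thesis
    unfolding * by (auto simp: Im_power sin_coeff_def elim!: oddE evenE)
qed

text \<open>The exponents 2i + 1 and 2(k - i) + 1 add up to 2k + 2, so each product of coefficients
  is w^(2k + 2) / (2k + 2)! times an odd-indexed binomial coefficient.\<close>

lemma sinh_fps_reflected_product:
  "(\<Sum>i\<le>k. (-1) ^ i * sinh_fps w $ i * sinh_fps w $ (k - i)) =
     w ^ (2 * k + 2) / fact (2 * k + 2)
       * of_real (2 ^ (k + 1) * fact (k + 1) * sin_coeff (k + 1))"
proof -
  have "(-1) ^ i * sinh_fps w $ i * sinh_fps w $ (k - i) =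
          w ^ (2 * k + 2) / fact (2 * k + 2)
            * of_real ((-1) ^ i * real (2 * k + 2 choose (2 * i + 1)))"
    if "i \<le> k" for i
  proof -
    have e: "2 * k + 2 - (2 * i + 1) = 2 * (k - i) + 1" "2 * k + 2 = (2 * i + 1) + (2 * (k - i) + 1)"
      using that by auto
    have "of_nat (2 * k + 2 choose (2 * i + 1)) =
            (fact (2 * k + 2) / (fact (2 * i + 1) * fact (2 * (k - i) + 1)) :: complex)"
      using that unfolding e(1)[symmetric] by (intro binomial_fact) simp
    moreover have "w ^ (2 * k + 2) = w ^ (2 * i + 1) * w ^ (2 * (k - i) + 1)"
      by (subst e(2)) (rule power_add)
    ultimately show ?thesis
      by (simp add: sinh_fps_def del: power_Suc fact_Suc)
  qed
  then show ?thesis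
    unfolding alternating_sum_odd_binomials[symmetric] of_real_sum sum_distrib_left
    by (intro sum.cong) auto
qed

lemma alternating_convolution_hermite_odd:
  fixes z :: complex
  defines "a \<equiv> \<lambda>m. hermite (2 * m + 1) z / fact (2 * m + 1)"
  shows "(\<Sum>i\<le>k. (-1) ^ i * a i * a (k - i)) =
           (2 * z) ^ (2 * k + 2) / fact (2 * k + 2)
             * of_real (2 ^ (k + 1) * fact (k + 1) * sin_coeff (k + 1))"
proof -
  define S where "S = sinh_fps (2 * z)"
  define A where "A = fps_exp (-1) * S"
  have reflect: "(F oo - fps_X) $ i = (-1) ^ i * F $ i" for F :: "complex fps" and i
    by (simp add: fps_compose_uminus')
  have exp_reflect: "fps_exp (-1) oo - fps_X = fps_exp (1::complex)"
    by (simp add: fps_eq_iff reflect flip: power_mult_distrib)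
  \<comment> \<open>Reflecting A absorbs the sign, so the alternating sum becomes an ordinary Cauchy
    product.\<close>
  have "(\<Sum>i\<le>k. (-1) ^ i * a i * a (k - i)) = ((A oo - fps_X) * A) $ k"
    by (simp add: a_def hermite_odd_over_fact A_def S_def fps_mult_nth[of "_ oo _"] reflect
                  atLeast0AtMost del: One_nat_def)
  also have "A oo - fps_X = fps_exp 1 * (S oo - fps_X)"
    by (simp add: A_def fps_compose_mult_distrib exp_reflect)
  also have "fps_exp 1 * (S oo - fps_X) * A = (fps_exp 1 * fps_exp (-1)) * ((S oo - fps_X) * S)"
    by (simp only: A_def mult_ac)
  also have "fps_exp 1 * fps_exp (-1) = (1 :: complex fps)"
    by (simp flip: fps_exp_add_mult)
  also have "(1 * ((S oo - fps_X) * S)) $ k = (\<Sum>i\<le>k. (-1) ^ i * S $ i * S $ (k - i))"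
    by (simp add: fps_mult_nth reflect atLeast0AtMost)
  finally show ?thesis
    by (simp only: S_def sinh_fps_reflected_product)
qed

text \<open>The power of 2 supplies exactly the factors 4^m and 4^n that complete the denominators
  to odd factorials; a single 1/2 is left over.\<close>

lemma hermite_double_term_altdef:
  "hermite_double_term x y m n =
     pochhammer (3/2) (m + n) * x ^ (m + n + 1) / 2
       * ((-1) ^ m * (hermite (2 * m + 1) (csqrt y) / fact (2 * m + 1))
                   * (hermite (2 * n + 1) (csqrt y) / fact (2 * n + 1)))"
proof -
  have powi: "(2::complex) powi (- 1 - 2 * int m - 2 * int n) = 1 / (2 * 4 ^ m * 4 ^ n)"
  proof -
    have "(- 1 - 2 * int m - 2 * int n) = - int (1 + 2 * m + 2 * n)" by simp
    then have "(2::complex) powi (- 1 - 2 * int m - 2 * int n) = 1 / 2 ^ (1 + 2 * m + 2 * n)"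
      by (simp only: power_int_minus_divide power_int_of_nat)
    then show ?thesis by (simp add: power_add power_mult)
  qed
  show ?thesis
    unfolding hermite_double_term_def pochhammer_three_halves[symmetric] powi
    by (simp add: mult_ac)
qed

lemma sum_hermite_double_term_diagonal:
  "(\<Sum>m\<le>k. hermite_double_term x y m (k - m)) = sin_coeff (Suc k) *\<^sub>R (2 * x * y) ^ Suc k"
proof -
  define s :: complex where "s = of_real (sin_coeff (k + 1))"
  have "(\<Sum>m\<le>k. hermite_double_term x y m (k - m)) =
          pochhammer (3/2) k * x ^ (k + 1) / 2
            * (\<Sum>m\<le>k. (-1) ^ m * (hermite (2 * m + 1) (csqrt y) / fact (2 * m + 1))
                * (hermite (2 * (k - m) + 1) (csqrt y) / fact (2 * (k - m) + 1)))"
    unfolding sum_distrib_left by (intro sum.cong) (simp_all add: hermite_double_term_altdef)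
  also have "\<dots> = pochhammer (3/2) k * x ^ (k + 1) / 2
                    * ((2 * csqrt y) ^ (2 * k + 2) / fact (2 * k + 2)
                    * (2 ^ (k + 1) * fact (k + 1) * s))"
    by (simp only: alternating_convolution_hermite_odd s_def of_real_mult of_real_power
                   of_real_fact of_real_numeral)
  \<comment> \<open>Only an even power of the square root survives, which removes the
    branch.\<close>
  also have "(2 * csqrt y) ^ (2 * k + 2) = 4 * 4 ^ k * y ^ (k + 1)"
  proof -
    have "(2 * csqrt y) ^ (2 * k + 2) = ((2 * csqrt y) ^ 2) ^ (k + 1)"
      unfolding power_mult[symmetric] by simp
    also have "(2 * csqrt y) ^ 2 = 4 * y"
      by (simp add: power_mult_distrib)
    finally show ?thesis
      by (simp add: power_mult_distrib)
  qed
  \<comment> \<open>Rewritten so that the Pochhammer factor common to the diagonal cancels.\<close>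
  also have "fact (2 * k + 2) = (2 * (of_nat k + 1) * (4 ^ k * pochhammer (3/2) k * fact k) :: complex)"
    unfolding pochhammer_three_halves by (simp add: algebra_simps)
  also have "pochhammer (3/2) k * x ^ (k + 1) / 2
               * (4 * 4 ^ k * y ^ (k + 1) / (2 * (of_nat k + 1) * (4 ^ k * pochhammer (3/2) k * fact k))
               * (2 ^ (k + 1) * fact (k + 1) * s)) = s * (2 * x * y) ^ (k + 1)"
  proof -
    have "pochhammer (3/2 :: complex) k \<noteq> 0"
      using pochhammer_three_halves[of k] by (metis fact_nonzero mult_zero_left mult_zero_right)
    moreover have "of_nat k + 1 \<noteq> (0::complex)"
      by (metis of_nat_Suc of_nat_eq_0_iff add.commute nat.distinct(1))
    moreover have "fact (k + 1) = (of_nat k + 1) * (fact k :: complex)"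
      by (simp add: algebra_simps)
    moreover define c :: complex where "c = of_nat k + 1"
    ultimately show ?thesis
      unfolding c_def[symmetric] by (simp add: power_mult_distrib del: fact_Suc)
  qed
  finally show ?thesis
    by (simp add: s_def scaleR_conv_of_real)
qed

theorem mainTheorem12:
  fixes x y :: complex
  assumes "(\<lambda>(m, n). hermite_double_term x y m n) summable_on (UNIV :: (nat \<times> nat) set)"
  shows "(\<Sum>\<^sub>\<infinity>(m, n)\<in>(UNIV :: (nat \<times> nat) set). hermite_double_term x y m n) = sin (2 * x * y)"
proof -
  let ?f = "\<lambda>(m, n). hermite_double_term x y m n"
  let ?L = "\<Sum>\<^sub>\<infinity>p\<in>UNIV. ?f p"
  have "(?f has_sum ?L) UNIV"
    using assms by (rule has_sum_infsum)
  \<comment> \<open>Unconditional summability permits regrouping by k = m + n; on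
    \<open>{..k}\<close> the natural subtraction \<open>k - m\<close> is not truncated.\<close>
  also have "(?f has_sum ?L) UNIV \<longleftrightarrow>
      ((\<lambda>(k, m). hermite_double_term x y m (k - m)) has_sum ?L) (SIGMA k:UNIV. {..k})"
    by (rule has_sum_reindex_bij_witness[of _ "\<lambda>(k, m). (m, k - m)" "\<lambda>(m, n). (m + n, m)"]) auto
  finally have "((\<lambda>k. \<Sum>m\<le>k. hermite_double_term x y m (k - m)) has_sum ?L) UNIV"
    by (rule has_sum_SigmaD) (auto intro: has_sum_finite)
  then have "(\<lambda>k. sin_coeff (Suc k) *\<^sub>R (2 * x * y) ^ Suc k) sums ?L"
    by (simp only: sum_hermite_double_term_diagonal has_sum_imp_sums)
  moreover have "(\<lambda>k. sin_coeff (Suc k) *\<^sub>R (2 * x * y) ^ Suc k) sums sin (2 * x * y)"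
    \<comment> \<open>The sine series has zero constant term, so starting at degree 1 keeps the
      sum.\<close>
    using sin_converges[of "2 * x * y"] by (subst sums_Suc_iff) simp
  ultimately show ?thesis
    by (rule sums_unique2)
qed

end
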